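(* For all $i,t\in V$ with $i\ne t$, the inequalities $$\sum_{j\in V\setminus\{i\}}y_{t,i,j}\ge 1\qquad\text{and}\qquad \sum_{j\in V\setminus\{i\}}y_{t,j,i}\ge 1$$ are facet-defining for $P_{\mathrm{utt}}(n)$.
   Context: Let $n\ge4$ be even, $V=\{1,\dots,n\}$ (teams; team $i$ has home venue $i$), $S=\{1,\dots,2n-2\}$ (slots), $A=\{(i,j)\in V\times V:i\ne j\}$, $\mathcal M=\{(k,i,j):k\in S,(i,j)\in A\}$, where $(k,i,j)$ denotes the match between $i$ and $j$ at venue $i$ in slot $k$. Coordinates are $x_{k,i,j}$ ($(k,i,j)\in\mathcal M$) and $y_{t,i,j}$ ($t\in V$, $(i,j)\in A$). A tournament is a set $T\subseteq\mathcal M$ whose incidence vector $x=\chi(T)\in\{0,1\}^{\mathcal M}$ satisfies $\sum_{j\in V\setminus\{i\}}(x_{k,i,j}+x_{k,j,i})=1$ for all $k\in S$, $k\ge2$, $i\in V$, and $\sum_{k\in S}x_{k,i,j}=1$ for all $(i,j)\in A$. In $T$, team $t$ is at venue $t$ in a slot where it plays at home and at venue $i$ in slot $k$ if $(k,i,t)\in T$; before slot 1 and after slot $2n-2$ it is at venue $t$. Team $t$ travels from venue $i$ to venue $j\ne i$ if it is at $i$ and then at $j$ at consecutive positions of (start, slot $1$, …, slot $2n-2$, end). The travel vector $\psi(T)\in\{0,1\}^{V\times A}$ has $\psi(T)_{t,i,j}=1$ iff team $t$ travels from $i$ to $j$. $P_{\mathrm{utt}}(n)=\mathrm{conv}\{(\chi(T),y)\in\{0,1\}^{\mathcal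 M}\times\{0,1\}^{V\times A}: T\text{ tournament},\ y\ge\psi(T)\}$. An inequality is facet-defining if it is valid and the face it induces is a facet. *)

theory Defs
  imports "HOL-Analysis.Analysis" "HOL-Library.Cardinality"
begin

definition teams :: "nat \<Rightarrow> nat set" where
  "teams n = {1..n}"

definition slots :: "nat \<Rightarrow> nat set" where
  "slots n = {1..2 * n - 2}"

definition arcs :: "nat \<Rightarrow> (nat \<times> nat) set" where
  "arcs n = {(i, j) \<in> teams n \<times> teams n. i \<noteq> j}"

text \<open>A match \<open>(k, i, j)\<close> is played in slot \<open>k\<close> at venue \<open>i\<close> (the home venue of \<open>i\<close>).\<close>

definition matches :: "nat \<Rightarrow> (nat \<times> nat \<times> nat) set" where
  "matches n = slots n \<times> arcs n"

definition travels :: "nat \<Rightarrow> (nat \<times> nat \<times> nat) set" where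
  "travels n = teams n \<times> arcs n"

text \<open>The function \<open>indicator T\<close> is the incidence vector of \<open>T\<close>. Slot 1 is deliberately
  not covered by the first family of equations.\<close>

definition tournament :: "nat \<Rightarrow> (nat \<times> nat \<times> nat) set \<Rightarrow> bool" where
  "tournament n T \<longleftrightarrow> T \<subseteq> matches n \<and>
    (\<forall>k\<in>slots n. k \<ge> 2 \<longrightarrow> (\<forall>i\<in>teams n.
      (\<Sum>j\<in>teams n - {i}. indicator T (k, i, j) + indicator T (k, j, i)) = (1::real))) \<and>
    (\<forall>(i, j)\<in>arcs n. (\<Sum>k\<in>slots n. indicator T (k, i, j)) = (1::real))"

text \<open>Position 0 is the start and position \<open>2 * n - 1\<close> the end; the positions in between
  are the slots.\<close>

definition at_venue :: "nat \<Rightarrow> (nat \<times> nat \<times> nat) set \<Rightarrow> nat \<Rightarrow> nat \<Rightarrow> nat \<Rightarrow> bool" where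
  "at_venue n T t k i \<longleftrightarrow>
    (k = 0 \<or> k = 2 * n - 1) \<and> i = t \<or>
    k \<in> slots n \<and> ((\<exists>j. (k, t, j) \<in> T) \<and> i = t \<or> (k, i, t) \<in> T)"

definition travels_from_to ::
    "nat \<Rightarrow> (nat \<times> nat \<times> nat) set \<Rightarrow> nat \<Rightarrow> nat \<Rightarrow> nat \<Rightarrow> bool" where
  "travels_from_to n T t i j \<longleftrightarrow>
    i \<noteq> j \<and> (\<exists>k\<in>{0..2 * n - 2}. at_venue n T t k i \<and> at_venue n T t (k + 1) j)"

text \<open>The number \<open>n\<close> of teams is the cardinality of a type \<open>'n\<close>, so that the coordinate
  spaces over \<open>matches n\<close> and \<open>travels n\<close> are Euclidean spaces. The class \<open>card2\<close>
  (at least two elements) makes both index sets nonempty.\<close>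

typedef ('n::card2) match_index = "matches CARD('n)"
proof
  show "(1, 1, 2) \<in> matches CARD('n)"
    using two_le_card[where 'a = 'n]
    by (auto simp: matches_def slots_def arcs_def teams_def)
qed

typedef ('n::card2) travel_index = "travels CARD('n)"
proof
  show "(1, 1, 2) \<in> travels CARD('n)"
    using two_le_card[where 'a = 'n]
    by (auto simp: travels_def arcs_def teams_def)
qed

lemma finite_arcs: "finite (arcs n)"
  by (rule finite_subset[of _ "teams n \<times> teams n"]) (auto simp: arcs_def teams_def)

instance match_index :: (card2) finite
proof
  have "finite (matches CARD('a))"
    by (simp add: matches_def slots_def finite_arcs)
  then show "finite (UNIV :: 'a match_index set)"
    by (simp add: type_definition.univ[OF type_definition_match_index])
qed

instance travel_index :: (card2) finite
proof
  have "finite (travels CARD('a))"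
    by (simp add: travels_def teams_def finite_arcs)
  then show "finite (UNIV :: 'a travel_index set)"
    by (simp add: type_definition.univ[OF type_definition_travel_index])
qed

type_synonym 'n utt_space = "(real ^ 'n match_index) \<times> (real ^ 'n travel_index)"

text \<open>The coordinate \<open>y\<^sub>t\<^sub>,\<^sub>i\<^sub>,\<^sub>j\<close>, meaningful only for \<open>(t, i, j) \<in> travels CARD('n)\<close>.\<close>

definition y_coord :: "('n::card2) utt_space \<Rightarrow> nat \<Rightarrow> nat \<Rightarrow> nat \<Rightarrow> real" where
  "y_coord z t i j = snd z $ Abs_travel_index (t, i, j)"

definition incidence_vec :: "(nat \<times> nat \<times> nat) set \<Rightarrow> real ^ ('n::card2) match_index" where
  "incidence_vec T = (\<chi> m. indicator T (Rep_match_index m))"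

definition travel_vec :: "(nat \<times> nat \<times> nat) set \<Rightarrow> real ^ ('n::card2) travel_index" where
  "travel_vec T = (\<chi> d. case Rep_travel_index d of (t, i, j) \<Rightarrow>
    if travels_from_to CARD('n) T t i j then 1 else 0)"

definition P_utt :: "('n::card2) utt_space set" where
  "P_utt = convex hull {(incidence_vec T, y) | T y.
    tournament CARD('n) T \<and> (\<forall>d. y $ d \<in> {0, 1}) \<and> (\<forall>d. y $ d \<ge> travel_vec T $ d)}"

text \<open>The linear inequality \<open>f z \<ge> b\<close> is facet-defining for \<open>P\<close>.\<close>

definition facet_defining :: "'a::euclidean_space set \<Rightarrow> ('a \<Rightarrow> real) \<Rightarrow> real \<Rightarrow> bool" where
  "facet_defining P f b \<longleftrightarrow>
    linear f \<and> (\<forall>z\<in>P. f z \<ge> b) \<and> {z \<in> P. f z = b} facet_of P"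

end

(* Team t visits venue i exactly once, so every tournament contains exactly one travel of t out of
   (into) i; hence every (chi(T), psi(T)) satisfies the inequality with equality. Raising travel
   coordinates outside the inequality stays on the face. For the travel variables inside it, take
   tournaments in which t plays away at i and at j in consecutive slots and swap home and away in
   the pairs {t, i} and {t, j} independently: the alternating sum of the four resulting points has
   zero match part, and its part on the variables of the inequality is a difference of two unit
   vectors. So the face spans a hyperplane of the affine hull of the polytope, whatever the
   dimension of the latter. *)
theory Submission
  imports Defs
begin

section \<open>Elementary facts on tournaments\<close>

lemma finite_teams [simp]: "finite (teams n)"
  by (simp add: teams_def)

lemma finite_slots [simp]: "finite (slots n)"
  by (simp add: slots_def)

lemma sum_indicator_eq_card:
  assumes "finite A"
  shows "(\<Sum>x\<in>A. indicator T (g x)) = real (card {x \<in> A. g x \<in> T})"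
  using assms by (simp add: indicator_def sum.If_cases Int_def)

text \<open>The equations start at slot 2; slot 1 is recovered by counting. Team \<open>u\<close>
  meets each of its \<open>n - 1\<close> opponents twice, and the \<open>2 * n - 3\<close> later
  slots take one match each, so exactly one of its \<open>2 * n - 2\<close> matches is left for slot
  1.\<close>

lemma tournament_slot:
  assumes T: "tournament n T" and k: "k \<in> slots n" and u: "u \<in> teams n"
  shows "(\<Sum>j\<in>teams n - {u}. indicator T (k, u, j) + indicator T (k, j, u)) = (1::real)"
proof (cases "k \<ge> 2")
  case True
  then show ?thesis using assms unfolding tournament_def by blast
next
  case False
  then have k1: "k = 1" and n: "n \<ge> 2" using k by (auto simp: slots_def)
  define s where
    "s k = (\<Sum>j\<in>teams n - {u}. indicator T (k, u, j) + indicator T (k, j, u) :: real)" for k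
  have arc: "(\<Sum>k\<in>slots n. indicator T (k, i, j)) = (1::real)" if "(i, j) \<in> arcs n" for i j
    using T that unfolding tournament_def by blast
  have "(\<Sum>k\<in>slots n. s k)
      = (\<Sum>j\<in>teams n - {u}. \<Sum>k\<in>slots n. indicator T (k, u, j) + indicator T (k, j, u))"
    unfolding s_def by (rule sum.swap)
  also have "\<dots> = (\<Sum>j\<in>teams n - {u}. 2)"
    by (rule sum.cong) (use u in \<open>auto simp: sum.distrib arc arcs_def\<close>)
  also have "\<dots> = 2 * real (n - 1)"
    using u by (simp add: teams_def)
  finally have total: "(\<Sum>k\<in>slots n. s k) = 2 * real (n - 1)" .
  have "(\<Sum>k\<in>slots n - {1}. s k) = (\<Sum>k\<in>slots n - {1}. 1)"
    by (rule sum.cong) (use T u in \<open>auto simp: tournament_def s_def slots_def\<close>)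
  also have "\<dots> = real (2 * n - 3)"
    using n by (simp add: slots_def)
  finally have "(\<Sum>k\<in>slots n. s k) = s 1 + real (2 * n - 3)"
    using k k1 by (simp add: sum.remove[of _ 1])
  with total n have "s 1 = 1" by (simp add: of_nat_diff)
  then show ?thesis by (simp add: s_def k1)
qed

lemma match_teams:
  assumes "tournament n T" and "(k, i, j) \<in> T"
  shows "k \<in> slots n" "i \<in> teams n" "j \<in> teams n" "i \<noteq> j"
  using assms by (auto simp: tournament_def matches_def arcs_def)

lemma match_ex1:
  assumes "tournament n T" and "(i, j) \<in> arcs n"
  shows "\<exists>!k. (k, i, j) \<in> T"
proof -
  have "(\<Sum>k\<in>slots n. indicator T (k, i, j)) = (1::real)"
    using assms unfolding tournament_def by blast
  then have "card {k \<in> slots n. (k, i, j) \<in> T} = 1"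
    by (simp add: sum_indicator_eq_card)
  moreover have "{k \<in> slots n. (k, i, j) \<in> T} = {k. (k, i, j) \<in> T}"
    using match_teams[OF assms(1)] by blast
  ultimately obtain k where "{k. (k, i, j) \<in> T} = {k}"
    by (auto simp: card_1_singleton_iff)
  then have "(l, i, j) \<in> T \<longleftrightarrow> l = k" for l by blast
  then show ?thesis by simp
qed

lemma match_unique:
  assumes "tournament n T" and "(k, i, j) \<in> T" and "(l, i, j) \<in> T"
  shows "k = l"
  using match_ex1[OF assms(1), of i j] assms match_teams[OF assms(1,2)]
  by (auto simp: arcs_def)

section \<open>Venues and travels of a team\<close>

lemma venue_in_teams:
  assumes "tournament n T" and "t \<in> teams n" and "at_venue n T t k v"
  shows "v \<in> teams n"
  using assms match_teams[OF assms(1)] by (auto simp: at_venue_def)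

lemma venue_ex1:
  assumes T: "tournament n T" and t: "t \<in> teams n" and k: "k \<le> 2 * n - 1"
  shows "\<exists>!v. at_venue n T t k v"
proof (cases "k \<in> slots n")
  case False
  then have "k = 0 \<or> k = 2 * n - 1" using k by (auto simp: slots_def)
  then show ?thesis using False by (auto simp: at_venue_def)
next
  case True
  let ?H = "{j \<in> teams n - {t}. (k, t, j) \<in> T}" and ?G = "{j \<in> teams n - {t}. (k, j, t) \<in> T}"
  have "real (card ?H) + real (card ?G) = 1"
    using tournament_slot[OF T True t] by (simp add: sum.distrib sum_indicator_eq_card)
  then have "card ?H + card ?G = 1" by linarith
  then consider "card ?H = 1" "card ?G = 0" | "card ?H = 0" "card ?G = 1" by linarith
  then have "(\<exists>j. ?H = {j}) \<and> ?G = {} \<or> ?H = {} \<and> (\<exists>j. ?G = {j})"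
    by cases (auto simp: card_1_singleton_iff)
  moreover have "?H = {j. (k, t, j) \<in> T}" "?G = {j. (k, j, t) \<in> T}"
    using match_teams[OF T] by blast+
  ultimately have "(\<exists>j. {j. (k, t, j) \<in> T} = {j}) \<and> {j. (k, j, t) \<in> T} = {} \<or>
      {j. (k, t, j) \<in> T} = {} \<and> (\<exists>j. {j. (k, j, t) \<in> T} = {j})" by (simp only:)
  then consider j where "{j. (k, t, j) \<in> T} = {j}" "{j. (k, j, t) \<in> T} = {}"
    | j where "{j. (k, t, j) \<in> T} = {}" "{j. (k, j, t) \<in> T} = {j}" by blast
  then show ?thesis
  proof cases
    case 1
    then have "at_venue n T t k v \<longleftrightarrow> v = t" for v
      using True by (auto simp: at_venue_def slots_def)
    then show ?thesis by simp
  next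
    case (2 j)
    then have "(k, v, t) \<in> T \<longleftrightarrow> v = j" "(k, t, v) \<notin> T" for v by auto
    then have "at_venue n T t k v \<longleftrightarrow> v = j" for v
      using True by (auto simp: at_venue_def slots_def)
    then show ?thesis by simp
  qed
qed

lemma venue_unique:
  assumes "tournament n T" and "t \<in> teams n"
    and "at_venue n T t k v" and "at_venue n T t k w"
  shows "v = w"
proof -
  have "k \<le> 2 * n - 1" using assms(3) by (auto simp: at_venue_def slots_def)
  from venue_ex1[OF assms(1,2) this] assms show ?thesis by blast
qed

lemma at_venue_away:
  assumes "i \<noteq> t"
  shows "at_venue n T t k i \<longleftrightarrow> k \<in> slots n \<and> (k, i, t) \<in> T"
  using assms by (auto simp: at_venue_def)

lemma at_venue_home:
  assumes "tournament n T" and "(k, t, j) \<in> T"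
  shows "at_venue n T t k t"
  using assms match_teams(1)[OF assms] by (auto simp: at_venue_def)

text \<open>The match of \<open>t\<close> at \<open>i\<close> is played once, so \<open>t\<close> is
  at venue \<open>i\<close> in slot \<open>k\<close> only, and its sole departure from there leads
  to the venue at the next position. That position may be the end,
  \<open>k + 1 = 2 * n - 1\<close>.\<close>

lemma travels_from_iff:
  assumes T: "tournament n T" and m: "(k, i, t) \<in> T" and v: "at_venue n T t (k + 1) v"
  shows "travels_from_to n T t i j \<longleftrightarrow> j = v"
proof -
  note mt = match_teams[OF T m]
  have vi: "v \<noteq> i"
  proof
    assume "v = i"
    with v mt have "(k + 1, i, t) \<in> T" by (simp add: at_venue_away)
    from match_unique[OF T m this] show False by simp
  qed
  have k: "k \<in> {0..2 * n - 2}" using mt by (auto simp: slots_def)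
  have at: "at_venue n T t k i" using mt m by (simp add: at_venue_away)
  have "j = v" if "at_venue n T t l i" "at_venue n T t (l + 1) j" for l
  proof -
    have "(l, i, t) \<in> T" using that(1) mt by (simp add: at_venue_away)
    then have "l = k" using match_unique[OF T _ m] by blast
    with that(2) v show ?thesis using venue_unique[OF T mt(3)] by blast
  qed
  then show ?thesis unfolding travels_from_to_def using vi k at v by blast
qed

lemma travels_to_iff:
  assumes T: "tournament n T" and m: "(k + 1, i, t) \<in> T" and v: "at_venue n T t k v"
  shows "travels_from_to n T t j i \<longleftrightarrow> j = v"
proof -
  note mt = match_teams[OF T m]
  have vi: "v \<noteq> i"
  proof
    assume "v = i"
    with v mt have "(k, i, t) \<in> T" by (simp add: at_venue_away)
    from match_unique[OF T m this] show False by simp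
  qed
  have k: "k \<in> {0..2 * n - 2}" using mt by (auto simp: slots_def)
  have at: "at_venue n T t (k + 1) i" using mt m by (simp add: at_venue_away)
  have "j = v" if "at_venue n T t (l + 1) i" "at_venue n T t l j" for l
  proof -
    have "(l + 1, i, t) \<in> T" using that(1) mt by (simp add: at_venue_away)
    then have "l + 1 = k + 1" using match_unique[OF T _ m] by blast
    with that(2) v show ?thesis using venue_unique[OF T mt(3)] by auto
  qed
  then show ?thesis unfolding travels_from_to_def using vi k at v by blast
qed

lemma travels_from_ex1:
  assumes T: "tournament n T" and a: "(i, t) \<in> arcs n"
  shows "\<exists>v\<in>teams n - {i}. \<forall>j. travels_from_to n T t i j \<longleftrightarrow> j = v"
proof -
  obtain k where m: "(k, i, t) \<in> T" using match_ex1[OF assms] by blast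
  note mt = match_teams[OF T m]
  then have "k + 1 \<le> 2 * n - 1" by (auto simp: slots_def)
  from venue_ex1[OF T mt(3) this] obtain v where v: "at_venue n T t (k + 1) v" by blast
  note iff = travels_from_iff[OF T m v]
  then have "v \<noteq> i" by (metis travels_from_to_def)
  with iff venue_in_teams[OF T mt(3) v] show ?thesis by blast
qed

lemma travels_to_ex1:
  assumes T: "tournament n T" and a: "(i, t) \<in> arcs n"
  shows "\<exists>v\<in>teams n - {i}. \<forall>j. travels_from_to n T t j i \<longleftrightarrow> j = v"
proof -
  obtain l where "(l, i, t) \<in> T" using match_ex1[OF assms] by blast
  \<comment> \<open>Slots start at 1, so slot \<open>l\<close> has a preceding position, which is
    the start when \<open>l = 1\<close>.\<close>
  moreover have "l \<noteq> 0" using match_teams[OF T calculation] by (simp add: slots_def)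
  ultimately obtain k where m: "(k + 1, i, t) \<in> T" by (metis Suc_eq_plus1 not0_implies_Suc)
  note mt = match_teams[OF T m]
  then have "k \<le> 2 * n - 1" by (auto simp: slots_def)
  from venue_ex1[OF T mt(3) this] obtain v where v: "at_venue n T t k v" by blast
  note iff = travels_to_iff[OF T m v]
  then have "v \<noteq> i" by (metis travels_from_to_def)
  with iff venue_in_teams[OF T mt(3) v] show ?thesis by blast
qed

section \<open>Schedules from one-factorizations\<close>

text \<open>The circle method: \<open>N\<close> plays the role of the point at infinity, and \<open>N\<close> being odd makes
  doubling invertible modulo \<open>N\<close>.\<close>

definition circle_colour :: "nat \<Rightarrow> nat \<Rightarrow> nat \<Rightarrow> nat" where
  "circle_colour N u v =
    (if u = N then 2 * v mod N else if v = N then 2 * u mod N else (u + v) mod N)"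

lemma circle_colour_sym: "circle_colour N u v = circle_colour N v u"
  by (simp add: circle_colour_def add.commute)

lemma mod_eq_less_iff:
  fixes a b r N :: nat
  assumes "r < N" "a + b < 2 * N"
  shows "(a + b) mod N = r \<longleftrightarrow> a + b = r \<or> a + b = r + N"
proof (cases "a + b < N")
  case True
  then show ?thesis using assms by auto
next
  case False
  then have "(a + b) mod N = a + b - N" using assms by (simp add: le_mod_geq)
  then show ?thesis using False assms by auto
qed

text \<open>Each colour class is a perfect matching. For \<open>u < N\<close> the congruence
  \<open>u + v = r\<close> modulo \<open>N\<close> has one solution \<open>v < N\<close>; it is the
  forbidden \<open>v = u\<close> exactly when \<open>2 * u = r\<close> modulo \<open>N\<close>, and
  then the partner is \<open>N\<close>.\<close>

lemma circle_colour_ex1: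
  assumes N: "odd N" and u: "u \<le> N" and r: "r < N"
  shows "\<exists>!v. v \<le> N \<and> v \<noteq> u \<and> circle_colour N u v = r"
proof (cases "u = N")
  case True
  \<comment> \<open>As \<open>N\<close> is odd, exactly one of \<open>r\<close> and
    \<open>r + N\<close> is even; its half solves \<open>2 * v = r\<close> modulo
    \<open>N\<close>.\<close>
  let ?v = "if even r then r div 2 else (r + N) div 2"
  show ?thesis
  proof (rule ex1I[of _ ?v])
    show "?v \<le> N \<and> ?v \<noteq> u \<and> circle_colour N u ?v = r"
      using N r True by (auto simp: circle_colour_def)
  next
    fix v assume v: "v \<le> N \<and> v \<noteq> u \<and> circle_colour N u v = r"
    then have "(v + v) mod N = r" "v < N" using True by (auto simp: circle_colour_def mult_2)
    then have "v + v = r \<or> v + v = r + N" using mod_eq_less_iff[of r N v v] r by simp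
    then show "v = ?v" using N by (auto, presburger+)
  qed
next
  case False
  then have u: "u < N" using u by simp
  have inf: "circle_colour N u N = 2 * u mod N" using False by (simp add: circle_colour_def)
  have fin: "circle_colour N u v = r \<longleftrightarrow> u + v = r \<or> u + v = r + N" if "v < N" for v
    using that u r by (simp add: circle_colour_def mod_eq_less_iff)
  have dbl: "2 * u mod N = r \<longleftrightarrow> u + u = r \<or> u + u = r + N"
    using mod_eq_less_iff[of r N u u] u r by (simp add: mult_2)
  show ?thesis
  proof (cases "2 * u mod N = r")
    case True
    show ?thesis
    proof (rule ex1I[of _ N])
      show "N \<le> N \<and> N \<noteq> u \<and> circle_colour N u N = r" using inf True u by simp
      fix v assume v: "v \<le> N \<and> v \<noteq> u \<and> circle_colour N u v = r"
      show "v = N"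
      proof (rule ccontr)
        assume "v \<noteq> N"
        with v fin[of v] True dbl u show False by auto
      qed
    qed
  next
    case neq: False
    let ?v = "if u \<le> r then r - u else r + N - u"
    show ?thesis
    proof (rule ex1I[of _ ?v])
      have "?v < N" using u r by auto
      moreover have "u + ?v = r \<or> u + ?v = r + N" using u by auto
      ultimately show "?v \<le> N \<and> ?v \<noteq> u \<and> circle_colour N u ?v = r"
        using fin[of ?v] neq dbl by (simp only:) auto
      fix v assume v: "v \<le> N \<and> v \<noteq> u \<and> circle_colour N u v = r"
      then have "v \<noteq> N" using inf neq by auto
      with v fin[of v] show "v = ?v" using r u by auto
    qed
  qed
qed

section \<open>One-factorizations with two prescribed colours\<close>

lemma ex_bij_betw_extend3:
  assumes "finite A" "finite B" "card A = card B"
    and "{a, b, c} \<subseteq> A" "distinct [a, b, c]" "{x, y, z} \<subseteq> B" "distinct [x, y, z]"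
  shows "\<exists>h. bij_betw h A B \<and> h a = x \<and> h b = y \<and> h c = z"
proof -
  have "card (A - {a, b, c}) = card (B - {x, y, z})"
    using assms by (simp add: card_Diff_subset)
  then obtain g where g: "bij_betw g (A - {a, b, c}) (B - {x, y, z})"
    using assms finite_same_card_bij by (metis finite_Diff)
  define h where "h = g(a := x, b := y, c := z)"
  have "bij_betw h (A - {a, b, c}) (B - {x, y, z})"
    using g by (rule bij_betw_cong[THEN iffD1, rotated]) (auto simp: h_def)
  moreover have "bij_betw h {a, b, c} {x, y, z}"
    using assms by (auto simp: h_def bij_betw_def inj_on_def)
  ultimately have "bij_betw h (A - {a, b, c} \<union> {a, b, c}) (B - {x, y, z} \<union> {x, y, z})"
    by (rule bij_betw_combine) auto
  moreover have "A - {a, b, c} \<union> {a, b, c} = A" "B - {x, y, z} \<union> {x, y, z} = B"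
    using assms by auto
  ultimately show ?thesis using assms by (auto simp: h_def intro!: exI[of _ h])
qed

lemma ex_one_factorization:
  assumes n: "n \<ge> 4" "even n" and abc: "{a, b, c} \<subseteq> teams n" "distinct [a, b, c]"
  shows "\<exists>col. (\<forall>u v. col u v = col v u) \<and>
    (\<forall>u\<in>teams n. \<forall>v\<in>teams n. col u v \<in> {1..n - 1}) \<and>
    (\<forall>u\<in>teams n. \<forall>r\<in>{1..n - 1}. \<exists>!v. v \<in> teams n \<and> v \<noteq> u \<and> col u v = r) \<and>
    col a b = (1::nat) \<and> col a c = 2"
proof -
  define N where "N = n - 1"
  have N: "odd N" "N \<ge> 3" "n = N + 1" using n by (auto simp: N_def)
  have half: "2 * (n div 2) = N + 1" using N(1) N(3) by simp
  \<comment> \<open>Team \<open>a\<close> becomes the point at infinity, so its colours are doubled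
    labels: \<open>b\<close> at 0 gives 0, and \<open>c\<close> at \<open>n div 2\<close> gives
    \<open>N + 1\<close>, which is 1 modulo \<open>N\<close>. The shift by 1 in \<open>col\<close>
    turns these into 1 and 2.\<close>
  have "\<exists>h. bij_betw h (teams n) {..N} \<and> h a = N \<and> h b = 0 \<and> h c = n div 2"
    by (rule ex_bij_betw_extend3) (use abc N half in \<open>auto simp: teams_def\<close>)
  then obtain h where h: "bij_betw h (teams n) {..N}" "h a = N" "h b = 0" "h c = n div 2" by blast
  define col where "col u v = circle_colour N (h u) (h v) + 1" for u v
  have "col u v = col v u" for u v by (simp add: col_def circle_colour_sym)
  moreover have "col u v \<in> {1..n - 1}" for u v
  proof -
    have "circle_colour N (h u) (h v) < N" using N by (simp add: circle_colour_def)
    then show ?thesis by (simp add: col_def N)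
  qed
  moreover have "\<exists>!v. v \<in> teams n \<and> v \<noteq> u \<and> col u v = r"
    if u: "u \<in> teams n" and r: "r \<in> {1..n - 1}" for u r
  proof -
    have hu: "h u \<le> N" using h(1) u by (auto simp: bij_betw_def)
    have "r - 1 < N" using r N by auto
    from circle_colour_ex1[OF N(1) hu this]
    obtain w where w: "w \<le> N" "w \<noteq> h u" "circle_colour N (h u) w = r - 1"
      and uniq: "\<And>w'. w' \<le> N \<Longrightarrow> w' \<noteq> h u \<Longrightarrow> circle_colour N (h u) w' = r - 1 \<Longrightarrow> w' = w"
      by blast
    have "w \<in> h ` teams n" using h(1) w(1) by (simp add: bij_betw_def)
    then obtain v where v: "v \<in> teams n" "h v = w" by blast
    show ?thesis
    proof (rule ex1I[of _ v])
      show "v \<in> teams n \<and> v \<noteq> u \<and> col u v = r" using v w r by (auto simp: col_def)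
      fix v' assume v': "v' \<in> teams n \<and> v' \<noteq> u \<and> col u v' = r"
      then have "h v' = w"
        using h(1) u by (intro uniq) (auto simp: bij_betw_def inj_on_def col_def)
      then show "v' = v" using v v' h(1) by (auto simp: bij_betw_def inj_on_def)
    qed
  qed
  moreover have "col a b = 1" "col a c = 2"
    using N half h by (simp_all add: col_def circle_colour_def mod_Suc)
  ultimately show ?thesis by blast
qed

text \<open>\<open>ori u v\<close> says that \<open>u\<close> hosts the first of its two matches against \<open>v\<close>. The second round
  robin runs in reverse order, so that the order of the last two slots mirrors that of the first
  two.\<close>

definition schedule ::
    "nat \<Rightarrow> (nat \<Rightarrow> nat \<Rightarrow> nat) \<Rightarrow> (nat \<Rightarrow> nat \<Rightarrow> bool) \<Rightarrow> (nat \<times> nat \<times> nat) set" where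
  "schedule n col ori = {(k, u, v). (u, v) \<in> arcs n \<and>
    k = (if ori u v then col u v else 2 * n - 1 - col u v)}"

text \<open>Slots \<open>r\<close> and \<open>2 * n - 1 - r\<close> both carry the perfect matching
  of colour \<open>r\<close>, with opposite venues because \<open>ori\<close> holds for exactly one
  order of each pair.\<close>

lemma tournament_schedule:
  assumes n: "n \<ge> 2" and sym: "\<And>u v. col u v = col v u"
    and range: "\<And>u v. u \<in> teams n \<Longrightarrow> v \<in> teams n \<Longrightarrow> col u v \<in> {1..n - 1}"
    and ex1: "\<And>u r. u \<in> teams n \<Longrightarrow> r \<in> {1..n - 1} \<Longrightarrow>
      \<exists>!v. v \<in> teams n \<and> v \<noteq> u \<and> col u v = r"
    and ori: "\<And>u v. u \<noteq> v \<Longrightarrow> ori u v \<longleftrightarrow> \<not> ori v u"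
  shows "tournament n (schedule n col ori)"
proof -
  let ?T = "schedule n col ori"
  have sub: "?T \<subseteq> matches n"
  proof
    fix x assume "x \<in> ?T"
    then obtain k u v where x: "x = (k, u, v)" "(u, v) \<in> arcs n"
      and k: "k = (if ori u v then col u v else 2 * n - 1 - col u v)"
      by (auto simp: schedule_def)
    then have "col u v \<in> {1..n - 1}" using range by (auto simp: arcs_def)
    then have "k \<in> slots n" using k by (auto simp: slots_def)
    then show "x \<in> matches n" using x by (simp add: matches_def)
  qed
  moreover have
    "(\<Sum>j\<in>teams n - {u}. indicator ?T (k, u, j) + indicator ?T (k, j, u)) = (1::real)"
    if k: "k \<in> slots n" and u: "u \<in> teams n" for k u
  proof -
    define r where "r = (if k \<le> n - 1 then k else 2 * n - 1 - k)"
    have r: "r \<in> {1..n - 1}" using k by (auto simp: r_def slots_def)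
    obtain v where v: "v \<in> teams n" "v \<noteq> u" "col u v = r"
      and uniq: "\<And>w. w \<in> teams n \<Longrightarrow> w \<noteq> u \<Longrightarrow> col u w = r \<Longrightarrow> w = v"
      using ex1[OF u r] by blast
    have "indicator ?T (k, u, j) + indicator ?T (k, j, u) = (if j = v then 1 else 0 :: real)"
      if j: "j \<in> teams n - {u}" for j
    proof -
      have j': "(u, j) \<in> arcs n" "(j, u) \<in> arcs n" using j u by (auto simp: arcs_def)
      have c: "col u j \<in> {1..n - 1}" using range u j by blast
      \<comment> \<open>Colours are at most \<open>n - 1\<close>, so the first round fills the slots
        up to \<open>n - 1\<close> and the second round the rest; \<open>k\<close> determines both
        the colour and the round.\<close>
      have "(k, u, j) \<in> ?T \<longleftrightarrow> col u j = r \<and> (ori u j \<longleftrightarrow> k \<le> n - 1)"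
        using j' c k by (auto simp: schedule_def r_def slots_def)
      moreover have "(k, j, u) \<in> ?T \<longleftrightarrow> col u j = r \<and> (ori j u \<longleftrightarrow> k \<le> n - 1)"
        using j' c k sym[of j u] by (auto simp: schedule_def r_def slots_def)
      moreover have "ori j u \<longleftrightarrow> \<not> ori u j" using ori j by blast
      moreover have "col u j = r \<longleftrightarrow> j = v" using uniq v j by blast
      ultimately show ?thesis by (auto simp: indicator_def)
    qed
    then have "(\<Sum>j\<in>teams n - {u}. indicator ?T (k, u, j) + indicator ?T (k, j, u))
        = (\<Sum>j\<in>teams n - {u}. if j = v then 1 else 0 :: real)"
      by (intro sum.cong) auto
    then show ?thesis using v by simp
  qed
  moreover have "(\<Sum>k\<in>slots n. indicator ?T (k, i, j)) = (1::real)" if "(i, j) \<in> arcs n" for i j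
  proof -
    let ?k = "if ori i j then col i j else 2 * n - 1 - col i j"
    have k: "(k, i, j) \<in> ?T \<longleftrightarrow> k = ?k" for k using that by (simp add: schedule_def)
    then have "(?k, i, j) \<in> ?T" by blast
    with sub have "?k \<in> slots n" by (auto simp: matches_def simp del: if_split)
    moreover have "(\<Sum>k\<in>slots n. indicator ?T (k, i, j))
        = (\<Sum>k\<in>slots n. if k = ?k then 1 else 0 :: real)"
      using k by (intro sum.cong) (auto simp: indicator_def)
    ultimately show ?thesis by simp
  qed
  ultimately show ?thesis unfolding tournament_def by blast
qed

text \<open>The parameters \<open>p\<close> and \<open>q\<close> swap home and away in the pairs \<open>{a, b}\<close> and \<open>{a, c}\<close>; these
  swaps are independent, so the four incidence vectors form a parallelogram.\<close>

lemma ex_tournament_parallelogram: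
  assumes n: "n \<ge> 4" "even n" and abc: "{a, b, c} \<subseteq> teams n" "distinct [a, b, c]"
  shows "\<exists>T. (\<forall>p q. tournament n (T p q)) \<and>
    (\<forall>q. (1, b, a) \<in> T True q) \<and> (\<forall>q. (2 * n - 2, b, a) \<in> T False q) \<and>
    (\<forall>p. (2, c, a) \<in> T p True) \<and> (\<forall>p. (2, a, c) \<in> T p False) \<and>
    (\<forall>p. (2 * n - 3, c, a) \<in> T p False) \<and> (\<forall>p. (2 * n - 3, a, c) \<in> T p True) \<and>
    (\<forall>m. indicator (T True True) m - indicator (T True False) m
      - indicator (T False True) m + indicator (T False False) m = (0::real))"
proof -
  obtain col where col_sym: "\<forall>u v. col u v = col v u"
    and col_range: "\<forall>u\<in>teams n. \<forall>v\<in>teams n. col u v \<in> {1..n - 1}"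
    and col_ex1: "\<forall>u\<in>teams n. \<forall>r\<in>{1..n - 1}. \<exists>!v. v \<in> teams n \<and> v \<noteq> u \<and> col u v = r"
    and col: "col a b = 1" "col a c = 2"
    using ex_one_factorization[OF assms] by (elim exE conjE)
  have col': "col b a = 1" "col c a = 2" using col col_sym by metis+
  \<comment> \<open>With \<open>p\<close> team \<open>b\<close>, and with \<open>q\<close> team
    \<open>c\<close>, hosts the first match against \<open>a\<close>. All other pairs keep a fixed
    orientation, for which \<open>u < v\<close> is an arbitrary choice.\<close>
  define ori where "ori p q u v =
    (if {u, v} = {a, b} then p \<longleftrightarrow> v = a else if {u, v} = {a, c} then q \<longleftrightarrow> v = a else u < v)"
    for p q :: bool and u v :: nat
  define T where "T p q = schedule n col (ori p q)" for p q
  have arcs: "(a, b) \<in> arcs n" "(b, a) \<in> arcs n" "(a, c) \<in> arcs n" "(c, a) \<in> arcs n"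
    using abc by (auto simp: arcs_def)
  have ori_eqs: "ori p q b a = p" "ori p q a b = (\<not> p)" "ori p q c a = q" "ori p q a c = (\<not> q)"
    for p q using abc by (auto simp: ori_def doubleton_eq_iff)
  show ?thesis
  proof (intro exI[of _ T] conjI allI)
    show "tournament n (T p q)" for p q
      unfolding T_def
    proof (rule tournament_schedule)
      show "ori p q u v \<longleftrightarrow> \<not> ori p q v u" if "u \<noteq> v" for u v
      proof -
        \<comment> \<open>Both orders of a pair fall into the same branch of \<open>ori\<close>; in
          the two special branches exactly one of \<open>u\<close> and \<open>v\<close> is
          \<open>a\<close>.\<close>
        have "v = a \<longleftrightarrow> u \<noteq> a" if "{u, v} = {a, w}" for w
          using that \<open>u \<noteq> v\<close> by blast
        then show ?thesis
          using \<open>u \<noteq> v\<close> unfolding ori_def insert_commute[of v u] by (simp add: linorder_neq_iff) auto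
      qed
    next
      show "n \<ge> 2" using n by simp
    next
      show "col u v = col v u" for u v using col_sym by blast
    next
      show "col u v \<in> {1..n - 1}" if "u \<in> teams n" "v \<in> teams n" for u v
        using col_range that by blast
    next
      show "\<exists>!v. v \<in> teams n \<and> v \<noteq> u \<and> col u v = r"
        if "u \<in> teams n" "r \<in> {1..n - 1}" for u r
        using col_ex1 that by blast
    qed
    show "(1, b, a) \<in> T True q" "(2 * n - 2, b, a) \<in> T False q" for q
      using arcs col' n by (auto simp: T_def schedule_def ori_eqs)
    show "(2, c, a) \<in> T p True" "(2, a, c) \<in> T p False" "(2 * n - 3, c, a) \<in> T p False"
      "(2 * n - 3, a, c) \<in> T p True" for p
      using arcs col col' n by (auto simp: T_def schedule_def ori_eqs)
    show "indicator (T True True) m - indicator (T True False) m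
            - indicator (T False True) m + indicator (T False False) m = (0::real)" for m
    proof -
      obtain k u v where m: "m = (k, u, v)" by (cases m) auto
      \<comment> \<open>Matches of \<open>{a, b}\<close> do not depend on \<open>q\<close>, and all
        others do not depend on \<open>p\<close>. So the four terms cancel in pairs that differ in
        \<open>q\<close> or in \<open>p\<close>, respectively.\<close>
      consider "{u, v} = {a, b}" | "{u, v} \<noteq> {a, b}" by blast
      then show ?thesis
      proof cases
        case 1
        then have ori_q: "ori p q u v = ori p False u v" for p q by (simp add: ori_def)
        have "m \<in> T p True \<longleftrightarrow> m \<in> T p False" for p
          by (simp only: m T_def schedule_def mem_Collect_eq case_prod_conv ori_q[of p True])
        then have "indicator (T p True) m = (indicator (T p False) m :: real)" for p
          by (simp add: indicator_def)
        then show ?thesis by simp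
      next
        case 2
        then have ori_p: "ori p q u v = ori False q u v" for p q by (simp add: ori_def)
        have "m \<in> T True q \<longleftrightarrow> m \<in> T False q" for q
          by (simp only: m T_def schedule_def mem_Collect_eq case_prod_conv ori_p[of True q])
        then have "indicator (T True q) m = (indicator (T False q) m :: real)" for q
          by (simp add: indicator_def)
        then show ?thesis by simp
      qed
    qed
  qed
qed

section \<open>Tournaments that avoid a given travel\<close>

lemma ex_third_team:
  assumes "n \<ge> 4"
  obtains e where "e \<in> teams n" "e \<noteq> a" "e \<noteq> b"
proof -
  have "\<not> teams n \<subseteq> {a, b}"
  proof
    assume "teams n \<subseteq> {a, b}"
    from card_mono[OF _ this] have "card (teams n) \<le> 2"
      by (auto simp: card_insert_if split: if_splits)
    then show False using assms by (simp add: teams_def)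
  qed
  then show ?thesis using that by blast
qed

text \<open>Supplies a tournament at which a chosen travel coordinate is 0 and hence can be raised.
  Fixing the venues of \<open>a\<close> in slots 1 and 2 suffices, since each foreign venue is
  entered and left once: either \<open>c\<close> is entered from \<open>e\<close>, or
  \<open>b\<close> is left for \<open>e\<close>, or \<open>c\<close> is visited before
  \<open>b\<close>.\<close>

lemma ex_tournament_avoiding:
  assumes n: "n \<ge> 4" "even n" and d: "(a, b, c) \<in> travels n"
  shows "\<exists>T. tournament n T \<and> \<not> travels_from_to n T a b c"
proof -
  have mem: "a \<in> teams n" "b \<in> teams n" "c \<in> teams n" "b \<noteq> c"
    using d by (auto simp: travels_def arcs_def)
  have away: "\<exists>T. tournament n T \<and> (1, u, a) \<in> T \<and> (2, v, a) \<in> T"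
    if uv: "u \<in> teams n" "v \<in> teams n" "u \<noteq> a" "v \<noteq> a" "u \<noteq> v" for u v
  proof -
    have "{a, u, v} \<subseteq> teams n" "distinct [a, u, v]" using uv mem by auto
    from ex_tournament_parallelogram[OF n this]
    obtain T where "\<forall>p q. tournament n (T p q)" "\<forall>q. (1, u, a) \<in> T True q"
      "\<forall>p. (2, v, a) \<in> T p True" by blast
    then show ?thesis by blast
  qed
  have slots: "1 \<in> slots n" "2 \<in> slots n" using n by (auto simp: slots_def)
  consider "b = a" | "c = a" | "b \<noteq> a" "c \<noteq> a" by blast
  then show ?thesis
  proof cases
    case 1
    obtain e where e: "e \<in> teams n" "e \<noteq> a" "e \<noteq> c" using ex_third_team[OF n(1)] by blast
    obtain T where T: "tournament n T" "(1, e, a) \<in> T" "(2, c, a) \<in> T"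
      using away[of e c] e mem 1 by auto
    have "at_venue n T a 1 e" using T e slots by (simp add: at_venue_away)
    then have "\<not> travels_from_to n T a a c"
      using travels_to_iff[OF T(1), of 1 c a e a] T e by (simp add: numeral_2_eq_2)
    then show ?thesis using T 1 by blast
  next
    case 2
    obtain e where e: "e \<in> teams n" "e \<noteq> a" "e \<noteq> b" using ex_third_team[OF n(1)] by blast
    obtain T where T: "tournament n T" "(1, b, a) \<in> T" "(2, e, a) \<in> T"
      using away[of b e] e mem 2 by auto
    have "at_venue n T a 2 e" using T e slots by (simp add: at_venue_away)
    then have "\<not> travels_from_to n T a b a"
      using travels_from_iff[OF T(1), of 1 b a e a] T e by (simp add: numeral_2_eq_2)
    then show ?thesis using T 2 by blast
  next
    case 3
    obtain T where T: "tournament n T" "(1, c, a) \<in> T" "(2, b, a) \<in> T"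
      using away[of c b] mem 3 by auto
    have "\<not> travels_from_to n T a b c"
    proof
      assume "travels_from_to n T a b c"
      then obtain k where k: "(k, b, a) \<in> T" "(k + 1, c, a) \<in> T"
        using 3 unfolding travels_from_to_def by (auto simp: at_venue_away)
      from match_unique[OF T(1) k(1) T(3)] match_unique[OF T(1) k(2) T(2)] show False by simp
    qed
    then show ?thesis using T by blast
  qed
qed

section \<open>Facets of the travelling tournament polytope\<close>

lemma travel_vec_Abs:
  assumes "(t, i, j) \<in> travels CARD('n::card2)"
  shows "(travel_vec T :: real ^ 'n travel_index) $ Abs_travel_index (t, i, j) =
    (if travels_from_to CARD('n) T t i j then 1 else 0)"
  using assms by (simp add: travel_vec_def Abs_travel_index_inverse)

lemma travel_vec_01: "travel_vec T $ d \<in> {0, 1}"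
  by (auto simp: travel_vec_def split: prod.splits)

lemma travel_vec_avoiding:
  fixes d :: "'n::card2 travel_index"
  assumes "CARD('n) \<ge> 4" "even CARD('n)"
  shows "\<exists>T. tournament CARD('n) T \<and> travel_vec T $ d = 0"
proof -
  obtain a b c where abc: "Rep_travel_index d = (a, b, c)" by (metis prod_cases3)
  with Rep_travel_index[of d] have "(a, b, c) \<in> travels CARD('n)" by simp
  from ex_tournament_avoiding[OF assms this] abc show ?thesis
    by (auto simp: travel_vec_def)
qed

lemma P_utt_I:
  assumes "tournament CARD('n::card2) T" and "\<And>d. y $ d \<in> {0, 1}"
    and "\<And>d. y $ d \<ge> travel_vec T $ d"
  shows "(incidence_vec T, y) \<in> (P_utt :: 'n utt_space set)"
  unfolding P_utt_def using assms by (intro hull_inc) blast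

section \<open>A facet criterion for inequalities in the travel variables\<close>

lemma subspace_affine_directions:
  assumes "affine W" and "w \<in> W"
  shows "subspace {v. w + v \<in> W}"
proof -
  have "{v. w + v \<in> W} = (\<lambda>x. - w + x) ` W"
    by (force simp: image_iff)
  then show ?thesis using affine_diffs_subspace[OF assms] by simp
qed

text \<open>The face has codimension at most 1 once the affine hull of the face and a single extra
  point \<open>p\<close> contains the polytope, and at least 1 because \<open>p\<close> is a point
  of the polytope off the face.\<close>

lemma facet_criterion:
  fixes S :: "'n::card2 travel_index set"
  assumes one: "\<And>T. tournament CARD('n) T \<Longrightarrow> (\<Sum>d\<in>S. travel_vec T $ d) = 1"
    and avoid: "\<And>d :: 'n travel_index. \<exists>T. tournament CARD('n) T \<and> travel_vec T $ d = 0"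
    and d0: "d0 \<in> S"
    and swap: "\<And>d. d \<in> S \<Longrightarrow> d \<noteq> d0 \<Longrightarrow> \<exists>T1 T2 T3 T4.
      tournament CARD('n) T1 \<and> tournament CARD('n) T2 \<and>
      tournament CARD('n) T3 \<and> tournament CARD('n) T4 \<and>
      (incidence_vec T1 - incidence_vec T2 - incidence_vec T3 + incidence_vec T4
        :: real ^ 'n match_index) = 0 \<and>
      (\<forall>e\<in>S. travel_vec T1 $ e - travel_vec T2 $ e - travel_vec T3 $ e + travel_vec T4 $ e =
        (axis d 1 - axis d0 1) $ e)"
  shows "facet_defining (P_utt :: 'n utt_space set) (\<lambda>z. \<Sum>d\<in>S. snd z $ d) 1"
proof -
  let ?P = "P_utt :: 'n utt_space set"
  define f where "f z = (\<Sum>d\<in>S. snd z $ d)" for z :: "'n utt_space"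
  define F where "F = {z \<in> ?P. f z = 1}"
  define point where "point T = ((incidence_vec T, travel_vec T) :: 'n utt_space)" for T
  define unit where "unit d = ((0, axis d 1) :: 'n utt_space)" for d

  have lin: "linear f"
    by (rule linearI) (auto simp: f_def sum.distrib sum_distrib_left)
  have f_unit: "f (unit d) = (if d \<in> S then 1 else 0)" for d
    by (simp add: f_def unit_def axis_def)
  have f_point: "f (point T) = 1" if "tournament CARD('n) T" for T
    using one[OF that] by (simp add: f_def point_def)
  have point_P: "point T \<in> ?P" if "tournament CARD('n) T" for T
    unfolding point_def by (rule P_utt_I) (use that travel_vec_01 in auto)
  have raise_P: "point T + unit d \<in> ?P" if "tournament CARD('n) T" "travel_vec T $ d = 0" for T d
  proof -
    have "(incidence_vec T, travel_vec T + axis d 1) \<in> ?P"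
    proof (rule P_utt_I)
      show "(travel_vec T + axis d 1) $ e \<in> {0, 1}" for e
        using that travel_vec_01[of T e] by (auto simp: axis_def)
    qed (use that in \<open>auto simp: axis_def\<close>)
    then show ?thesis by (simp add: point_def unit_def)
  qed

  have "?P \<subseteq> {z. f z \<ge> 1}"
    unfolding P_utt_def
  proof (rule hull_minimal)
    show "convex {z. f z \<ge> 1}"
      using convex_linear_vimage[OF lin, of "{1..}"] by (simp add: vimage_def)
    show "{(incidence_vec T, y) |T y. tournament CARD('n) T \<and>
        (\<forall>d. y $ d \<in> {0, 1}) \<and> (\<forall>d. y $ d \<ge> travel_vec T $ d)} \<subseteq> {z. f z \<ge> 1}"
    proof clarify
      fix T and y :: "real ^ 'n travel_index"
      assume T: "tournament CARD('n) T" and y: "\<forall>d. y $ d \<ge> travel_vec T $ d"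
      have "(\<Sum>d\<in>S. travel_vec T $ d) \<le> (\<Sum>d\<in>S. y $ d)" using y by (intro sum_mono) simp
      then show "f (incidence_vec T, y) \<ge> 1" using one[OF T] by (simp add: f_def)
    qed
  qed
  then have valid: "f z \<ge> 1" if "z \<in> ?P" for z using that by blast

  \<comment> \<open>The vector \<open>adjoint f 1\<close> is the normal of \<open>f\<close>; it puts
    the face into supporting hyperplane form.\<close>
  have f_inner: "f z = adjoint f 1 \<bullet> z" for z
    using adjoint_works[OF lin, of z 1] by (simp add: inner_commute)
  have "F = ?P \<inter> {z. adjoint f 1 \<bullet> z = 1}"
    by (auto simp: F_def f_inner)
  moreover have "?P \<inter> {z. adjoint f 1 \<bullet> z = 1} face_of ?P"
    by (rule face_of_Int_supporting_hyperplane_ge)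
      (use valid in \<open>auto simp: P_utt_def simp flip: f_inner\<close>)
  ultimately have face: "F face_of ?P" by simp

  have point_F: "point T \<in> F" if "tournament CARD('n) T" for T
    using that by (simp add: F_def point_P f_point)
  obtain T0 where T0: "tournament CARD('n) T0" "travel_vec T0 $ d0 = 0"
    using avoid[of d0] by blast
  \<comment> \<open>Raising the coordinate \<open>d0\<close>, which is 0 at \<open>T0\<close>, gives
    \<open>f\<close> the value 2.\<close>
  define p where "p = point T0 + unit d0"
  have p: "p \<in> ?P" "f p = 2"
    using T0 d0 by (simp_all add: p_def raise_P linear_add[OF lin] f_point f_unit)

  define W where "W = affine hull (insert p F)"
  have W: "affine W" "insert p F \<subseteq> W" by (simp_all add: W_def hull_subset)
  then have point_W: "point T \<in> W" if "tournament CARD('n) T" for T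
    using point_F that by blast
  \<comment> \<open>\<open>V\<close> is the direction space of \<open>W\<close>. The aim is to show
    that it contains every \<open>unit d\<close>.\<close>
  define V where "V = {v. point T0 + v \<in> W}"
  have V: "subspace V"
    unfolding V_def by (rule subspace_affine_directions) (use W point_W T0 in auto)
  have diff: "x - y \<in> V" if "x \<in> W" "y \<in> W" for x y
  proof -
    have "(x - point T0) - (y - point T0) \<in> V"
      by (rule subspace_diff[OF V]) (use that in \<open>auto simp: V_def\<close>)
    then show ?thesis by simp
  qed
  have add_W: "x + v \<in> W" if "x \<in> W" "v \<in> V" for x v
  proof -
    have "(x - point T0) + v \<in> V"
      by (rule subspace_add[OF V]) (use that in \<open>auto simp: V_def\<close>)
    then show ?thesis by (simp add: V_def)
  qed

  have unit_notin: "unit d \<in> V" if "d \<notin> S" for d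
  proof -
    obtain T where T: "tournament CARD('n) T" "travel_vec T $ d = 0"
      using avoid[of d] by blast
    then have "point T + unit d \<in> F"
      using that by (simp add: F_def raise_P linear_add[OF lin] f_point f_unit)
    then have "(point T + unit d) - point T \<in> V" using T W by (intro diff point_W) auto
    then show ?thesis by simp
  qed
  have unit_d0: "unit d0 \<in> V"
    using W by (simp add: V_def p_def)
  have expand: "(0, y) = (\<Sum>d\<in>UNIV. y $ d *\<^sub>R unit d)" for y :: "real ^ 'n travel_index"
  proof -
    have "snd (\<Sum>d\<in>UNIV. y $ d *\<^sub>R unit d) = y"
      by (simp add: snd_sum unit_def vec_eq_iff axis_def if_distrib cong: if_cong)
    moreover have "fst (\<Sum>d\<in>UNIV. y $ d *\<^sub>R unit d) = 0"
      by (simp add: fst_sum unit_def)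
    ultimately show ?thesis by (simp add: prod_eq_iff)
  qed
  have supp: "(0, y) \<in> V" if "\<forall>e\<in>S. y $ e = 0" for y
    unfolding expand[of y]
  proof (rule subspace_sum[OF V])
    show "y $ d *\<^sub>R unit d \<in> V" for d
      using that unit_notin[of d] subspace_scale[OF V] subspace_0[OF V] by (cases "d \<in> S") auto
  qed
  have unit_V: "unit d \<in> V" for d
  proof (cases "d \<in> S \<and> d \<noteq> d0")
    case False
    then show ?thesis using unit_notin unit_d0 by blast
  next
    case True
    with swap obtain T1 T2 T3 T4 where T: "tournament CARD('n) T1" "tournament CARD('n) T2"
        "tournament CARD('n) T3" "tournament CARD('n) T4"
      and inc: "(incidence_vec T1 - incidence_vec T2 - incidence_vec T3 + incidence_vec T4
        :: real ^ 'n match_index) = 0"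
      and tv: "\<And>e. e \<in> S \<Longrightarrow>
        travel_vec T1 $ e - travel_vec T2 $ e - travel_vec T3 $ e + travel_vec T4 $ e =
        (axis d 1 - axis d0 1 :: real ^ 'n travel_index) $ e"
      by metis
    \<comment> \<open>Off \<open>S\<close> nothing is known about the alternating sum. The error
      \<open>r\<close> vanishes on \<open>S\<close>, so it lies in \<open>V\<close> by
      \<open>supp\<close>; removing it leaves \<open>unit d - unit d0\<close>.\<close>
    define r where "r = travel_vec T1 - travel_vec T2 - travel_vec T3 + travel_vec T4
      - (axis d 1 - axis d0 1 :: real ^ 'n travel_index)"
    have r: "(0, r) \<in> V" by (rule supp) (use tv in \<open>simp add: r_def\<close>)
    have "(point T1 - point T2) - (point T3 - point T4) \<in> V"
      using T by (intro subspace_diff[OF V] diff point_W)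
    from subspace_add[OF V subspace_diff[OF V this r] unit_d0] have
      "((point T1 - point T2) - (point T3 - point T4)) - (0, r) + unit d0 \<in> V" .
    moreover have "((point T1 - point T2) - (point T3 - point T4)) - (0, r) + unit d0 = unit d"
      using inc by (simp add: point_def unit_def r_def algebra_simps)
    ultimately show ?thesis by simp
  qed

  have "?P \<subseteq> W"
    unfolding P_utt_def
  proof (rule hull_minimal)
    show "convex W" using W by (simp add: affine_imp_convex)
    show "{(incidence_vec T, y) |T y. tournament CARD('n) T \<and>
        (\<forall>d. y $ d \<in> {0, 1}) \<and> (\<forall>d. y $ d \<ge> travel_vec T $ d)} \<subseteq> W"
    proof clarify
      fix T and y :: "real ^ 'n travel_index" assume T: "tournament CARD('n) T"
      \<comment> \<open>Every generator of the polytope differs from some \<open>point T\<close> in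
        travel coordinates only.\<close>
      have "(0, y - travel_vec T) \<in> V"
        unfolding expand[of "y - travel_vec T"]
        by (intro subspace_sum[OF V] subspace_scale[OF V] unit_V)
      from add_W[OF point_W[OF T] this] show "(incidence_vec T, y) \<in> W"
        by (simp add: point_def)
    qed
  qed
  then have "aff_dim ?P \<le> aff_dim W" by (rule aff_dim_subset)
  also have "\<dots> \<le> aff_dim F + 1"
    by (simp add: W_def aff_dim_insert)
  finally have "aff_dim ?P \<le> aff_dim F + 1" .
  moreover have "aff_dim F < aff_dim ?P"
  proof (rule face_of_aff_dim_lt[OF _ face])
    show "convex ?P" by (simp add: P_utt_def)
    have "p \<notin> F" using p by (simp add: F_def)
    then show "F \<noteq> ?P" using p by blast
  qed
  ultimately have "F facet_of ?P"
    using face point_F[OF T0(1)] by (auto simp: facet_of_def)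
  then show ?thesis
    using lin valid by (simp add: facet_defining_def F_def f_def[abs_def])
qed

lemma sum_travel_image:
  fixes g :: "nat \<Rightarrow> nat \<times> nat \<times> nat" and z :: "real ^ ('n::card2) travel_index"
  assumes "inj_on g J" and "g ` J \<subseteq> travels CARD('n)"
  shows "(\<Sum>d\<in>(Abs_travel_index \<circ> g) ` J. z $ d) = (\<Sum>j\<in>J. z $ Abs_travel_index (g j))"
proof -
  have inj: "inj_on (Abs_travel_index \<circ> g :: nat \<Rightarrow> 'n travel_index) J"
    using assms by (auto simp: inj_on_def Abs_travel_index_inject image_subset_iff)
  show ?thesis by (subst sum.reindex[OF inj]) simp
qed

text \<open>Here \<open>g j\<close> is \<open>(t, i, j)\<close> or \<open>(t, j, i)\<close>, and \<open>R T j\<close> says that \<open>T\<close> contains this travel.\<close>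

lemma facet_criterion_arcs:
  fixes g :: "nat \<Rightarrow> nat \<times> nat \<times> nat" and i t :: nat
  defines "R \<equiv> \<lambda>T j. case g j of (t, i, j) \<Rightarrow> travels_from_to CARD('n::card2) T t i j"
  assumes n: "CARD('n) \<ge> 4" "even CARD('n)"
    and t: "t \<in> teams CARD('n)" "t \<noteq> i"
    and inj: "inj_on g (teams CARD('n) - {i})"
    and g: "g ` (teams CARD('n) - {i}) \<subseteq> travels CARD('n)"
    and one: "\<And>T. tournament CARD('n) T \<Longrightarrow>
      \<exists>v\<in>teams CARD('n) - {i}. \<forall>j\<in>teams CARD('n) - {i}. R T j \<longleftrightarrow> j = v"
    and swap: "\<And>c. c \<in> teams CARD('n) \<Longrightarrow> c \<noteq> i \<Longrightarrow> c \<noteq> t \<Longrightarrow> \<exists>T1 T2 T3 T4.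
      tournament CARD('n) T1 \<and> tournament CARD('n) T2 \<and>
      tournament CARD('n) T3 \<and> tournament CARD('n) T4 \<and>
      (\<forall>m. indicator T1 m - indicator T2 m - indicator T3 m + indicator T4 m = (0::real)) \<and>
      (\<forall>j\<in>teams CARD('n) - {i}.
        (R T1 j \<longleftrightarrow> j = c) \<and> (R T2 j \<longleftrightarrow> j = t) \<and> (R T3 j \<longleftrightarrow> j = t) \<and> (R T4 j \<longleftrightarrow> j = t))"
  shows "facet_defining (P_utt :: 'n utt_space set)
    (\<lambda>z. \<Sum>j\<in>teams CARD('n) - {i}. snd z $ Abs_travel_index (g j)) 1"
proof -
  let ?J = "teams CARD('n) - {i}"
  define e where "e = (Abs_travel_index \<circ> g :: nat \<Rightarrow> 'n travel_index)"
  have e_inj: "e j = e j' \<longleftrightarrow> j = j'" if "j \<in> ?J" "j' \<in> ?J" for j j'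
    using inj g that by (auto simp: e_def Abs_travel_index_inject image_subset_iff inj_on_def)
  have tv: "travel_vec T $ e j = (if R T j then 1 else 0)" if "j \<in> ?J" for T j
  proof -
    obtain a b c where gj: "g j = (a, b, c)" by (metis prod_cases3)
    moreover have "(a, b, c) \<in> travels CARD('n)" using g that gj by (metis image_subset_iff)
    ultimately show ?thesis by (simp add: e_def R_def travel_vec_Abs)
  qed
  have "facet_defining (P_utt :: 'n utt_space set) (\<lambda>z. \<Sum>d\<in>e ` ?J. snd z $ d) 1"
  proof (rule facet_criterion)
    fix T assume "tournament CARD('n) T"
    with one obtain v where v: "v \<in> ?J" "\<And>j. j \<in> ?J \<Longrightarrow> R T j \<longleftrightarrow> j = v" by blast
    have "(\<Sum>d\<in>e ` ?J. travel_vec T $ d) = (\<Sum>j\<in>?J. travel_vec T $ e j)"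
      using sum_travel_image[OF inj g, of "travel_vec T"] by (simp add: e_def)
    also have "\<dots> = (\<Sum>j\<in>?J. if j = v then 1 else 0)"
      by (rule sum.cong) (auto simp: tv v(2))
    finally show "(\<Sum>d\<in>e ` ?J. travel_vec T $ d) = 1" using v(1) by simp
  next
    show "\<exists>T. tournament CARD('n) T \<and> travel_vec T $ d = 0" for d :: "'n travel_index"
      using n by (rule travel_vec_avoiding)
    \<comment> \<open>The reference coordinate \<open>d0\<close> is \<open>e t\<close>, in the
      applications the trip between \<open>i\<close> and the home venue \<open>t\<close>;
      \<open>swap\<close> trades it for the coordinate of \<open>c\<close>.\<close>
    show "e t \<in> e ` ?J" using t by blast
  next
    fix d assume "d \<in> e ` ?J" "d \<noteq> e t"
    then obtain c where c: "c \<in> ?J" "c \<noteq> t" "d = e c" by blast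
    then obtain T1 T2 T3 T4 where T: "tournament CARD('n) T1" "tournament CARD('n) T2"
        "tournament CARD('n) T3" "tournament CARD('n) T4"
      and inc: "\<And>m. indicator T1 m - indicator T2 m - indicator T3 m + indicator T4 m = (0::real)"
      and RT: "\<And>j. j \<in> ?J \<Longrightarrow>
        (R T1 j \<longleftrightarrow> j = c) \<and> (R T2 j \<longleftrightarrow> j = t) \<and> (R T3 j \<longleftrightarrow> j = t) \<and> (R T4 j \<longleftrightarrow> j = t)"
      using swap[of c] by (metis DiffE singletonI)
    have "(incidence_vec T1 - incidence_vec T2 - incidence_vec T3 + incidence_vec T4
        :: real ^ 'n match_index) = 0"
      by (simp add: vec_eq_iff incidence_vec_def inc)
    moreover have "travel_vec T1 $ x - travel_vec T2 $ x - travel_vec T3 $ x + travel_vec T4 $ x =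
        (axis d 1 - axis (e t) 1) $ x" if "x \<in> e ` ?J" for x
    proof -
      from that obtain j where j: "j \<in> ?J" "x = e j" by blast
      have "t \<in> ?J" using t by simp
      with j c show ?thesis by (simp add: tv RT e_inj axis_def)
    qed
    ultimately show "\<exists>T1 T2 T3 T4. tournament CARD('n) T1 \<and> tournament CARD('n) T2 \<and>
      tournament CARD('n) T3 \<and> tournament CARD('n) T4 \<and>
      (incidence_vec T1 - incidence_vec T2 - incidence_vec T3 + incidence_vec T4
        :: real ^ 'n match_index) = 0 \<and>
      (\<forall>x\<in>e ` ?J. travel_vec T1 $ x - travel_vec T2 $ x - travel_vec T3 $ x + travel_vec T4 $ x =
        (axis d 1 - axis (e t) 1) $ x)"
      using T by blast
  qed
  then show ?thesis
    using sum_travel_image[OF inj g] by (simp add: e_def)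
qed

theorem theorem14:
  fixes n i t :: nat
  assumes "n = CARD('n::card2)" and "n \<ge> 4" and "even n"
    and "i \<in> teams n" and "t \<in> teams n" and "i \<noteq> t"
  shows "facet_defining (P_utt :: 'n utt_space set)
           (\<lambda>z. \<Sum>j\<in>teams n - {i}. y_coord z t i j) 1 \<and>
          facet_defining (P_utt :: 'n utt_space set)
           (\<lambda>z. \<Sum>j\<in>teams n - {i}. y_coord z t j i) 1"
proof -
  note n = assms(1)
  have arc: "(i, t) \<in> arcs n" using assms by (simp add: arcs_def)
  have trav: "(t, i, j) \<in> travels n" "(t, j, i) \<in> travels n" if "j \<in> teams n - {i}" for j
    using assms that by (auto simp: travels_def arcs_def)
  have slots: "2 \<in> slots n" "2 * n - 3 \<in> slots n" "2 * n - 3 \<noteq> 0" "2 * n - 3 \<noteq> 2 * n - 1"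
    using assms by (auto simp: slots_def)
  have suc: "2 * n - 3 + 1 = 2 * n - 2" "2 * n - 2 + 1 = 2 * n - 1" "(0::nat) + 1 = 1"
    "(1::nat) + 1 = 2"
    using assms by auto
  \<comment> \<open>With \<open>p\<close> the visit to \<open>i\<close> is in slot 1:
    \<open>t\<close> comes from the start and leaves for its venue in slot 2, which is
    \<open>c\<close> iff \<open>q\<close>. Otherwise it is in slot \<open>2 * n - 2\<close>:
    \<open>t\<close> leaves for the end and comes from its venue in slot \<open>2 * n - 3\<close>,
    which is \<open>c\<close> iff not \<open>q\<close>.\<close>
  have par: "\<exists>T. (\<forall>p q. tournament n (T p q)) \<and>
      (\<forall>p q j. travels_from_to n (T p q) t i j \<longleftrightarrow> j = (if p \<and> q then c else t)) \<and>
      (\<forall>p q j. travels_from_to n (T p q) t j i \<longleftrightarrow> j = (if p \<or> q then t else c)) \<and>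
      (\<forall>m. indicator (T True True) m - indicator (T True False) m
            - indicator (T False True) m + indicator (T False False) m = (0::real))"
    if c: "c \<in> teams n" "c \<noteq> i" "c \<noteq> t" for c
  proof -
    have triple: "{t, i, c} \<subseteq> teams n" "distinct [t, i, c]" using assms c by auto
    obtain T where T: "\<And>p q. tournament n (T p q)"
      and i: "\<And>q. (1, i, t) \<in> T True q" "\<And>q. (2 * n - 2, i, t) \<in> T False q"
      and c_match: "\<And>p. (2, c, t) \<in> T p True" "\<And>p. (2, t, c) \<in> T p False"
        "\<And>p. (2 * n - 3, c, t) \<in> T p False" "\<And>p. (2 * n - 3, t, c) \<in> T p True"
      and par: "\<And>m. indicator (T True True) m - indicator (T True False) m
            - indicator (T False True) m + indicator (T False False) m = (0::real)"
      using ex_tournament_parallelogram[OF assms(2,3) triple] by blast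
    \<comment> \<open>\<open>travels_to_iff\<close> expects the slot as a successor; the predecessor
      of slot 1 is the start, position 0.\<close>
    have i': "\<And>q. (0 + 1, i, t) \<in> T True q" "\<And>q. (2 * n - 3 + 1, i, t) \<in> T False q"
      using i suc by simp_all
    have "at_venue n (T True True) t (1 + 1) c" "at_venue n (T True False) t (1 + 1) t"
      "\<And>q. at_venue n (T False q) t (2 * n - 2 + 1) t"
      unfolding suc using c slots c_match(1) at_venue_home[OF T c_match(2)]
      by (simp_all add: at_venue_away, simp add: at_venue_def)
    note out = travels_from_iff[OF T i(1) this(1)] travels_from_iff[OF T i(1) this(2)]
      travels_from_iff[OF T i(2) this(3)]
    have "at_venue n (T False True) t (2 * n - 3) t" "at_venue n (T False False) t (2 * n - 3) c"
      "\<And>q. at_venue n (T True q) t 0 t"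
      using c slots c_match(3) at_venue_home[OF T c_match(4)]
      by (simp_all add: at_venue_away at_venue_def[of n _ t 0])
    note into = travels_to_iff[OF T i'(2) this(1)] travels_to_iff[OF T i'(2) this(2)]
      travels_to_iff[OF T i'(1) this(3)]
    have "travels_from_to n (T p q) t i j \<longleftrightarrow> j = (if p \<and> q then c else t)" for p q j
      using out by (cases p; cases q) simp_all
    moreover have "travels_from_to n (T p q) t j i \<longleftrightarrow> j = (if p \<or> q then t else c)" for p q j
      using into by (cases p; cases q) simp_all
    ultimately show ?thesis using T par by blast
  qed
  have "facet_defining (P_utt :: 'n utt_space set)
      (\<lambda>z. \<Sum>j\<in>teams CARD('n) - {i}. snd z $ Abs_travel_index (t, i, j)) 1"
  proof (rule facet_criterion_arcs[where t = t], goal_cases)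
    \<comment> \<open>Goals 7 and 8 are the hypotheses \<open>one\<close> and \<open>swap\<close> of
      the criterion.\<close>
    case (7 T)
    then show ?case using travels_from_ex1[of n T i t] arc n by fastforce
  next
    case (8 c)
    then obtain T where T: "\<And>p q. tournament n (T p q)"
      "\<And>p q j. travels_from_to n (T p q) t i j \<longleftrightarrow> j = (if p \<and> q then c else t)"
      "\<And>m. indicator (T True True) m - indicator (T True False) m
            - indicator (T False True) m + indicator (T False False) m = (0::real)"
      using par[of c] n by blast
    \<comment> \<open>Only \<open>T True True\<close> has \<open>t\<close> leave \<open>i\<close>
      for \<open>c\<close>; in the other three \<open>t\<close> goes home.\<close>
    show ?case
      by (rule exI[of _ "T True True"], rule exI[of _ "T True False"],
          rule exI[of _ "T False True"], rule exI[of _ "T False False"])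
        (use T n in simp)
  qed (use assms trav in \<open>auto simp: inj_on_def\<close>)
  moreover have "facet_defining (P_utt :: 'n utt_space set)
      (\<lambda>z. \<Sum>j\<in>teams CARD('n) - {i}. snd z $ Abs_travel_index (t, j, i)) 1"
  proof (rule facet_criterion_arcs[where t = t], goal_cases)
    case (7 T)
    then show ?case using travels_to_ex1[of n T i t] arc n by fastforce
  next
    case (8 c)
    then obtain T where T: "\<And>p q. tournament n (T p q)"
      "\<And>p q j. travels_from_to n (T p q) t j i \<longleftrightarrow> j = (if p \<or> q then t else c)"
      "\<And>m. indicator (T True True) m - indicator (T True False) m
            - indicator (T False True) m + indicator (T False False) m = (0::real)"
      using par[of c] n by blast
    show ?case
      \<comment> \<open>Now only \<open>T False False\<close> has \<open>t\<close> enter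
        \<open>i\<close> from \<open>c\<close>, so it takes the first place; reversing the order of
        the four keeps the signs.\<close>
      by (rule exI[of _ "T False False"], rule exI[of _ "T False True"],
          rule exI[of _ "T True False"], rule exI[of _ "T True True"])
        (use T n in \<open>simp add: algebra_simps\<close>)
  qed (use assms trav in \<open>auto simp: inj_on_def\<close>)
  ultimately show ?thesis by (simp add: y_coord_def n)
qed

end
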